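(* Let $(X,d)$ be a Samuel realcompact metric space and $(D,\chi)$ be any uniformly discrete space. Then $$H(U_{d+\chi}(X\times D))=H(U_d(X))\times H(U_\chi(D))=X\times\upsilon D=\upsilon X\times\upsilon D=\upsilon(X\times D).$$
   Context: A uniformly discrete space $(D,\chi)$ is a set $D$ with the metric $\chi(a,b)=0$ if $a=b$ and $\chi(a,b)=1$ otherwise. $d+\chi$ is the sum metric on $X\times D$. For a metric space $(Z,\delta)$ with its metric uniformity, $U_\delta(Z)$ is the set of real-valued uniformly continuous functions and $wU_\delta(Z)$ is the weakest uniformity on $Z$ making all $f\in U_\delta(Z)$ uniformly continuous. A space is realcompact if it is homeomorphic to a closed subspace of a product of real lines; a realcompactification of $Z$ is a realcompact space in which $Z$ is densely embedded. $H(U_\delta(Z))$ is the Samuel realcompactification: the smallest realcompactification of $Z$ to which every $f\in U_\delta(Z)$ extends continuously; topologically it is the completion of $(Z,wU_\delta(Z))$. $(Z,\delta)$ is Samuel realcompact if $Z=H(U_\delta(Z))$, equivalently if $(Z,wU_\delta(Z))$ is complete. $\upsilon Z$ denotes the Hewitt realcompactification of $Z$. Equality of realcompactifications means equivalence: there is a homeomorphism between them leaving the base space (here $X\times D$) pointwise fixed. *)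

theory Defs
  imports "HOL-Analysis.Analysis"
begin

section \<open>Metric spaces\<close>

definition unif_discrete_metric :: "'a set \<Rightarrow> 'a metric" where
  "unif_discrete_metric D = metric (D, \<lambda>a b. if a = b then 0 else 1)"

definition sum_metric :: "'a metric \<Rightarrow> 'b metric \<Rightarrow> ('a \<times> 'b) metric" where
  "sum_metric m1 m2 = metric (mspace m1 \<times> mspace m2,
     \<lambda>p q. mdist m1 (fst p) (fst q) + mdist m2 (snd p) (snd q))"

definition unif_cont_funs :: "'a metric \<Rightarrow> ('a \<Rightarrow> real) set" where
  "unif_cont_funs m = {f. uniformly_continuous_map m euclidean_metric f}"

lemma unif_discrete_metric_simps [simp]:
  "mspace (unif_discrete_metric D) = D"
  "mdist (unif_discrete_metric D) = (\<lambda>a b. if a = b then 0 else 1)"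
proof -
  interpret Metric_space D "\<lambda>a b. if a = b then 0 else 1"
    by unfold_locales auto
  show "mspace (unif_discrete_metric D) = D"
    "mdist (unif_discrete_metric D) = (\<lambda>a b. if a = b then 0 else 1)"
    by (simp_all add: unif_discrete_metric_def)
qed

lemma sum_metric_simps [simp]:
  "mspace (sum_metric m1 m2) = mspace m1 \<times> mspace m2"
  "mdist (sum_metric m1 m2) = (\<lambda>p q. mdist m1 (fst p) (fst q) + mdist m2 (snd p) (snd q))"
proof -
  interpret Metric_space "mspace m1 \<times> mspace m2"
    "\<lambda>p q. mdist m1 (fst p) (fst q) + mdist m2 (snd p) (snd q)"
  proof unfold_locales
    fix x y z :: "'a \<times> 'b"
    assume "x \<in> mspace m1 \<times> mspace m2" "y \<in> mspace m1 \<times> mspace m2" "z \<in> mspace m1 \<times> mspace m2"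
    then show "mdist m1 (fst x) (fst z) + mdist m2 (snd x) (snd z)
      \<le> mdist m1 (fst x) (fst y) + mdist m2 (snd x) (snd y)
        + (mdist m1 (fst y) (fst z) + mdist m2 (snd y) (snd z))"
      using mdist_triangle[of "fst x" m1 "fst y" "fst z"] mdist_triangle[of "snd x" m2 "snd y" "snd z"]
      by (auto simp: mem_Times_iff)
  qed (auto simp: mdist_commute add_nonneg_eq_0_iff)
  show "mspace (sum_metric m1 m2) = mspace m1 \<times> mspace m2"
    "mdist (sum_metric m1 m2) = (\<lambda>p q. mdist m1 (fst p) (fst q) + mdist m2 (snd p) (snd q))"
    by (simp_all add: sum_metric_def)
qed


section \<open>Realcompactifications\<close>

text \<open>The index set of the product is taken inside the type \<open>'k \<Rightarrow> real\<close>; this is no restriction,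
  see \<open>realcompact_spaceI\<close> below.\<close>

definition realcompact_space :: "'k topology \<Rightarrow> bool" where
  "realcompact_space K \<longleftrightarrow>
     (\<exists>(I :: ('k \<Rightarrow> real) set) S.
        closedin (product_topology (\<lambda>_. euclideanreal) I) S \<and>
        K homeomorphic_space subtopology (product_topology (\<lambda>_. euclideanreal) I) S)"

text \<open>Extensions of a space \<open>Z\<close> are given as a space \<open>K\<close> with an explicit embedding \<open>e\<close>.\<close>

definition realcompactification :: "'a topology \<Rightarrow> 'k topology \<Rightarrow> ('a \<Rightarrow> 'k) \<Rightarrow> bool" where
  "realcompactification Z K e \<longleftrightarrow>
     realcompact_space K \<and> embedding_map Z K e \<and> K closure_of (e ` topspace Z) = topspace K"

definition extends_continuously ::
    "'a topology \<Rightarrow> 'k topology \<Rightarrow> ('a \<Rightarrow> 'k) \<Rightarrow> ('a \<Rightarrow> real) \<Rightarrow> bool" where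
  "extends_continuously Z K e f \<longleftrightarrow>
     (\<exists>F. continuous_map K euclideanreal F \<and> (\<forall>z \<in> topspace Z. F (e z) = f z))"

definition ext_le ::
    "'a topology \<Rightarrow> 'k topology \<Rightarrow> ('a \<Rightarrow> 'k) \<Rightarrow> 'l topology \<Rightarrow> ('a \<Rightarrow> 'l) \<Rightarrow> bool" where
  "ext_le Z K e K' e' \<longleftrightarrow> (\<exists>h. continuous_map K' K h \<and> (\<forall>z \<in> topspace Z. h (e' z) = e z))"

definition ext_equiv ::
    "'a topology \<Rightarrow> 'k topology \<Rightarrow> ('a \<Rightarrow> 'k) \<Rightarrow> 'l topology \<Rightarrow> ('a \<Rightarrow> 'l) \<Rightarrow> bool" where
  "ext_equiv Z K e K' e' \<longleftrightarrow> (\<exists>h. homeomorphic_map K K' h \<and> (\<forall>z \<in> topspace Z. h (e z) = e' z))"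

text \<open>\<open>H_realcompactification Z L K e\<close>: \<open>(K, e)\<close> is the realcompactification \<open>H(L)\<close> of \<open>Z\<close>, the
  smallest one to which all functions in \<open>L\<close> extend. It is determined up to equivalence.
  Minimality is tested against the spaces on the type \<open>'a set set\<close>. Every Hausdorff space in which
  \<open>Z\<close> is dense has a copy there (send a point to the trace of its neighbourhood filter on \<open>Z\<close>), so
  this is minimality among all realcompactifications, see \<open>H_realcompactification_least\<close> below.\<close>

definition H_realcompactification ::
    "'a topology \<Rightarrow> ('a \<Rightarrow> real) set \<Rightarrow> 'k topology \<Rightarrow> ('a \<Rightarrow> 'k) \<Rightarrow> bool" where
  "H_realcompactification Z L K e \<longleftrightarrow>
     realcompactification Z K e \<and> (\<forall>f \<in> L. extends_continuously Z K e f) \<and>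
     (\<forall>(K' :: 'a set set topology) e'.
        realcompactification Z K' e' \<and> (\<forall>f \<in> L. extends_continuously Z K' e' f)
        \<longrightarrow> ext_le Z K e K' e')"

definition samuel_realcompactification :: "'a metric \<Rightarrow> 'k topology \<Rightarrow> ('a \<Rightarrow> 'k) \<Rightarrow> bool" where
  "samuel_realcompactification m = H_realcompactification (mtopology_of m) (unif_cont_funs m)"

definition samuel_realcompact :: "'a metric \<Rightarrow> bool" where
  "samuel_realcompact m \<longleftrightarrow> samuel_realcompactification m (mtopology_of m) id"

text \<open>The Hewitt realcompactification is the realcompactification in which \<open>Z\<close> is C-embedded.\<close>

definition hewitt_realcompactification :: "'a topology \<Rightarrow> 'k topology \<Rightarrow> ('a \<Rightarrow> 'k) \<Rightarrow> bool" where
  "hewitt_realcompactification Z K e \<longleftrightarrow>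
     realcompactification Z K e \<and>
     (\<forall>f. continuous_map Z euclideanreal f \<longrightarrow> extends_continuously Z K e f)"


section \<open>Independence of the auxiliary types\<close>

lemma realcompact_spaceI:
  fixes I :: "'i set" and K :: "'k topology"
  assumes S: "closedin (product_topology (\<lambda>_. euclideanreal) I) S"
    and hom: "K homeomorphic_space subtopology (product_topology (\<lambda>_. euclideanreal) I) S"
  shows "realcompact_space K"
proof -
  let ?P = "\<lambda>J. product_topology (\<lambda>_. euclideanreal) J"
  obtain \<phi> where \<phi>: "homeomorphic_map K (subtopology (?P I) S) \<phi>"
    using hom homeomorphic_space by blast
  have SI: "S \<subseteq> topspace (?P I)"
    using S closedin_subset by blast
  have im: "\<phi> ` topspace K = S"
    using homeomorphic_imp_surjective_map[OF \<phi>] SI by (auto simp: topspace_subtopology)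
  define p where "p i = (\<lambda>k. if k \<in> topspace K then \<phi> k i else 0)" for i
  define J where "J = p ` I"
  define \<sigma> where "\<sigma> = inv_into I p"
  have \<sigma>: "\<sigma> j \<in> I" "p (\<sigma> j) = j" if "j \<in> J" for j
    using that unfolding J_def \<sigma>_def by (auto intro: inv_into_into f_inv_into_f)
  define \<psi> where "\<psi> s = restrict (\<lambda>j. s (\<sigma> j)) J" for s :: "'i \<Rightarrow> real"
  define \<rho> where "\<rho> t = restrict (\<lambda>i. t (p i)) I" for t :: "('k \<Rightarrow> real) \<Rightarrow> real"
  have pI: "p i \<in> J" if "i \<in> I" for i
    using that by (auto simp: J_def)
  have c\<psi>: "continuous_map (?P I) (?P J) \<psi>"
    unfolding continuous_map_componentwise
    by (auto simp: \<psi>_def intro!: continuous_map_product_projection \<sigma>)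
  have c\<rho>: "continuous_map (?P J) (?P I) \<rho>"
    unfolding continuous_map_componentwise
    by (auto simp: \<rho>_def intro!: continuous_map_product_projection pI)
  have \<rho>\<psi>: "\<rho> (\<psi> s) = s" if "s \<in> S" for s
  proof -
    obtain k where k: "k \<in> topspace K" "s = \<phi> k"
      using \<open>s \<in> S\<close> im by blast
    have "s (\<sigma> (p i)) = s i" if "i \<in> I" for i
      using \<sigma>(2)[OF pI[OF that]] k by (auto simp: p_def fun_eq_iff split: if_splits)
    moreover have "s \<in> extensional I"
      using SI \<open>s \<in> S\<close> by (auto simp: PiE_def)
    ultimately show ?thesis
      by (auto simp: \<rho>_def \<psi>_def fun_eq_iff pI restrict_def extensional_def)
  qed
  have \<psi>\<rho>: "\<psi> (\<rho> t) = t" if "t \<in> topspace (?P J)" for t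
  proof
    fix j
    show "\<psi> (\<rho> t) j = t j"
      using that \<sigma>[of j] by (cases "j \<in> J") (simp_all add: \<rho>_def \<psi>_def PiE_def extensional_def)
  qed
  define T where "T = {t \<in> topspace (?P J). \<rho> t \<in> S}"
  have T: "closedin (?P J) T"
    unfolding T_def using c\<rho> S closedin_continuous_map_preimage by blast
  have "homeomorphic_maps (subtopology (?P I) S) (subtopology (?P J) T) \<psi> \<rho>"
    unfolding homeomorphic_maps_def
  proof (intro conjI)
    have "\<psi> s \<in> T" if "s \<in> S" for s
      using that \<rho>\<psi>[OF that] continuous_map_funspace[OF c\<psi>] SI by (auto simp: T_def Pi_iff)
    then show "continuous_map (subtopology (?P I) S) (subtopology (?P J) T) \<psi>"
      by (intro continuous_map_into_subtopology continuous_map_from_subtopology c\<psi>) auto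
    show "continuous_map (subtopology (?P J) T) (subtopology (?P I) S) \<rho>"
      by (intro continuous_map_into_subtopology continuous_map_from_subtopology c\<rho>)
        (auto simp: T_def)
  qed (auto simp: \<rho>\<psi> \<psi>\<rho> simp del: topspace_product_topology)
  then have "subtopology (?P I) S homeomorphic_space subtopology (?P J) T"
    unfolding homeomorphic_space_def by blast
  then show ?thesis
    unfolding realcompact_space_def using hom T homeomorphic_space_trans by blast
qed

lemma realcompact_space_homeomorphic:
  fixes K :: "'k topology" and K' :: "'l topology"
  assumes "realcompact_space K'" "K homeomorphic_space K'"
  shows "realcompact_space K"
proof -
  obtain I :: "('l \<Rightarrow> real) set" and S where "closedin (product_topology (\<lambda>_. euclideanreal) I) S"
      "K' homeomorphic_space subtopology (product_topology (\<lambda>_. euclideanreal) I) S"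
    using \<open>realcompact_space K'\<close> unfolding realcompact_space_def by blast
  then show ?thesis
    using assms(2) homeomorphic_space_trans realcompact_spaceI by blast
qed

lemma realcompact_imp_Hausdorff_space:
  "realcompact_space K \<Longrightarrow> Hausdorff_space K"
  unfolding realcompact_space_def
  by (metis Hausdorff_space_euclidean Hausdorff_space_product_topology Hausdorff_space_subtopology
      homeomorphic_Hausdorff_space)

lemma extension_copy:
  fixes Z :: "'a topology" and K :: "'k topology"
  assumes K: "realcompactification Z K e"
  obtains K' :: "'a set set topology" and e' where
    "realcompactification Z K' e'" "ext_equiv Z K e K' e'" "ext_equiv Z K' e' K e"
proof -
  have dense: "K closure_of (e ` topspace Z) = topspace K"
    and rc: "realcompact_space K" and emb: "embedding_map Z K e"
    using K by (auto simp: realcompactification_def)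
  have T2: "Hausdorff_space K"
    using rc by (rule realcompact_imp_Hausdorff_space)
  have cont_e: "continuous_map Z K e"
    using emb by (metis continuous_map_in_subtopology embedding_map_def homeomorphic_imp_continuous_map)
  define g where "g k = {A. \<exists>U. openin K U \<and> k \<in> U \<and> A = {z \<in> topspace Z. e z \<in> U}}" for k
  have inj: "inj_on g (topspace K)"
  proof (rule inj_onI, rule ccontr)
    fix x y assume xy: "x \<in> topspace K" "y \<in> topspace K" "g x = g y" "x \<noteq> y"
    then obtain U V where UV: "openin K U" "openin K V" "x \<in> U" "y \<in> V" "disjnt U V"
      using T2 by (metis Hausdorff_space_def)
    then have "{z \<in> topspace Z. e z \<in> U} \<in> g y"
      using xy(3) by (auto simp: g_def)
    then obtain W where W: "openin K W" "y \<in> W" "{z \<in> topspace Z. e z \<in> U} = {z \<in> topspace Z. e z \<in> W}"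
      by (auto simp: g_def)
    have "y \<in> K closure_of (e ` topspace Z)" "openin K (W \<inter> V)" "y \<in> W \<inter> V"
      using dense xy W UV by auto
    then obtain z where "z \<in> topspace Z" "e z \<in> W \<inter> V"
      unfolding in_closure_of by blast
    then show False
      using W UV by (auto simp: disjnt_iff)
  qed
  define g' where "g' = inv_into (topspace K) g"
  define K' where "K' = pullback_topology (g ` topspace K) g' K"
  have g'g: "g' (g k) = k" if "k \<in> topspace K" for k
    using that inj by (simp add: g'_def)
  have tK': "topspace K' = g ` topspace K"
    by (auto simp: K'_def topspace_pullback_topology g'g)
  have maps: "homeomorphic_maps K K' g g'"
    unfolding homeomorphic_maps_def
  proof (intro conjI ballI)
    show "continuous_map K' K g'"
      unfolding K'_def by (metis continuous_map_id continuous_map_pullback id_comp)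
    have "continuous_map K K (g' \<circ> g)"
      by (rule continuous_map_eq[OF continuous_map_id]) (simp add: g'g)
    then show "continuous_map K K' g"
      unfolding K'_def by (rule continuous_map_pullback') auto
  qed (auto simp: tK' g'g)
  have hg: "homeomorphic_map K K' g" and hg': "homeomorphic_map K' K g'"
    using maps homeomorphic_maps_map homeomorphic_maps_sym by blast+
  have eK: "e z \<in> topspace K" if "z \<in> topspace Z" for z
    using cont_e that continuous_map_funspace by fastforce
  have "realcompact_space K'"
    using rc hg' homeomorphic_space realcompact_space_homeomorphic by blast
  moreover have "embedding_map Z K' (g \<circ> e)"
    using emb hg
    by (intro embedding_map_compose) (auto simp flip: surjective_embedding_map)
  moreover have "K' closure_of ((g \<circ> e) ` topspace Z) = topspace K'"
    using homeomorphic_map_closure_of[OF hg, of "e ` topspace Z"] dense eK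
    by (auto simp: image_comp tK')
  ultimately have "realcompactification Z K' (g \<circ> e)"
    by (simp add: realcompactification_def)
  moreover have "ext_equiv Z K e K' (g \<circ> e)"
    unfolding ext_equiv_def using hg by auto
  moreover have "ext_equiv Z K' (g \<circ> e) K e"
    unfolding ext_equiv_def using hg' eK g'g by auto
  ultimately show thesis
    using that by blast
qed

lemma H_realcompactification_least:
  fixes Z :: "'a topology" and K :: "'k topology" and M :: "'l topology"
  assumes K: "H_realcompactification Z L K e"
    and M: "realcompactification Z M i" "\<And>f. f \<in> L \<Longrightarrow> extends_continuously Z M i f"
  shows "ext_le Z K e M i"
proof -
  obtain M' :: "'a set set topology" and i' where M': "realcompactification Z M' i'"
      "ext_equiv Z M i M' i'" "ext_equiv Z M' i' M i"
    using extension_copy[OF M(1)] .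
  obtain h where h: "continuous_map M' M h" "\<forall>z\<in>topspace Z. h (i' z) = i z"
    using M'(3) homeomorphic_imp_continuous_map unfolding ext_equiv_def by blast
  obtain h' where h': "continuous_map M M' h'" "\<forall>z\<in>topspace Z. h' (i z) = i' z"
    using M'(2) homeomorphic_imp_continuous_map unfolding ext_equiv_def by blast
  have "extends_continuously Z M' i' f" if f: "f \<in> L" for f
  proof -
    obtain F where "continuous_map M euclideanreal F" "\<forall>z\<in>topspace Z. F (i z) = f z"
      using M(2)[OF f] unfolding extends_continuously_def by blast
    then show ?thesis
      unfolding extends_continuously_def using h
      by (intro exI[of _ "F \<circ> h"]) (auto intro: continuous_map_compose)
  qed
  then have "ext_le Z K e M' i'"
    using K M' unfolding H_realcompactification_def by blast
  then obtain k where "continuous_map M' K k" "\<forall>z\<in>topspace Z. k (i' z) = e z"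
    unfolding ext_le_def by blast
  then show ?thesis
    unfolding ext_le_def using h'
    by (intro exI[of _ "k \<circ> h'"]) (auto intro: continuous_map_compose)
qed


section \<open>Existence\<close>

text \<open>The closure of the image of the evaluation map in \<open>\<real>\<^sup>L\<close> is \<open>H(L)\<close>.\<close>

lemma H_realcompactification_exists:
  fixes m :: "'a metric" and L :: "('a \<Rightarrow> real) set"
  defines "P \<equiv> product_topology (\<lambda>_. euclideanreal) L"
  defines "e \<equiv> \<lambda>z. restrict (\<lambda>f. f z) L"
  assumes UL: "unif_cont_funs m \<subseteq> L"
    and LC: "\<And>f. f \<in> L \<Longrightarrow> continuous_map (mtopology_of m) euclideanreal f"
  shows "H_realcompactification (mtopology_of m) L
           (subtopology P (P closure_of (e ` mspace m))) e"
proof -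
  let ?Z = "mtopology_of m" and ?S = "P closure_of (e ` mspace m)"
  let ?K = "subtopology P ?S"
  interpret Metric_space "mspace m" "mdist m"
    by (rule Metric_space_mspace_mdist)
  have Z: "?Z = mtopology"
    by (simp add: mtopology_of_def)
  have dL: "(\<lambda>z. mdist m x z) \<in> L" if "x \<in> mspace m" for x
  proof -
    have "uniformly_continuous_map m euclidean_metric (\<lambda>z. mdist m x z)"
      using uniformly_continuous_map_mdist[of m m "\<lambda>z. x" "\<lambda>z. z"] that
      by (simp add: uniformly_continuous_map_const)
    then show ?thesis
      using UL by (auto simp: unif_cont_funs_def)
  qed
  have eP: "e ` mspace m \<subseteq> topspace P"
    by (auto simp: e_def P_def)
  have ce: "continuous_map ?Z P e"
    unfolding P_def continuous_map_componentwise
    by (auto simp: e_def LC)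
  have "inj_on e (mspace m)"
  proof (rule inj_onI)
    fix x y assume xy: "x \<in> mspace m" "y \<in> mspace m" "e x = e y"
    have "e x (\<lambda>z. mdist m x z) = e y (\<lambda>z. mdist m x z)"
      by (simp add: xy)
    then show "x = y"
      using xy dL[OF xy(1)] by (simp add: e_def)
  qed
  moreover have "open_map ?Z (subtopology P (e ` mspace m)) e"
    unfolding open_map_def
  proof (intro allI impI)
    fix U assume U: "openin ?Z U"
    show "openin (subtopology P (e ` mspace m)) (e ` U)"
    proof (subst openin_subopen, intro ballI)
      fix q assume "q \<in> e ` U"
      then obtain x where x: "x \<in> U" "q = e x" by blast
      have xm: "x \<in> mspace m"
        using U x openin_subset by (fastforce simp: Z)
      obtain r where r: "r > 0" "mball x r \<subseteq> U"
        using U x unfolding Z openin_mtopology by blast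
      define W where "W = {t \<in> topspace P. t (\<lambda>z. mdist m x z) \<in> {..<r}}"
      have cp: "continuous_map P euclideanreal (\<lambda>t. t (\<lambda>z. mdist m x z))"
        unfolding P_def by (rule continuous_map_product_projection[OF dL[OF xm]])
      have "openin P W"
        unfolding W_def by (rule openin_continuous_map_preimage[OF cp]) simp
      moreover have "q \<in> W"
        using x xm r dL[OF xm] eP by (auto simp: W_def e_def image_subset_iff)
      moreover have "e ` mspace m \<inter> W \<subseteq> e ` U"
      proof
        fix s assume "s \<in> e ` mspace m \<inter> W"
        then obtain y where y: "y \<in> mspace m" "s = e y" "e y \<in> W" by blast
        then have "mdist m x y < r"
          using dL[OF xm] by (simp add: W_def e_def)
        then show "s \<in> e ` U"
          using y xm r by auto
      qed
      ultimately show "\<exists>T. openin (subtopology P (e ` mspace m)) T \<and> q \<in> T \<and> T \<subseteq> e ` U"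
        using x xm openin_subtopology_Int2[of P W "e ` mspace m"]
        by (intro exI[of _ "e ` mspace m \<inter> W"]) auto
    qed
  qed
  ultimately have "homeomorphic_map ?Z (subtopology P (e ` mspace m)) e"
    using ce eP by (intro bijective_open_imp_homeomorphic_map)
      (auto simp: continuous_map_in_subtopology)
  then have "embedding_map ?Z P e"
    by (simp add: embedding_map_def)
  then have emb: "embedding_map ?Z ?K e"
    unfolding embedding_map_in_subtopology using closure_of_subset[OF eP] by auto
  have dense: "?K closure_of (e ` topspace ?Z) = topspace ?K"
    using closure_of_subset[OF eP]
    by (simp add: closure_of_subtopology Int_absorb1 closure_of_subset_topspace)
  have rc: "realcompact_space ?K"
    by (rule realcompact_spaceI[of L ?S]) (auto simp: P_def)
  have ext: "extends_continuously ?Z ?K e f" if "f \<in> L" for f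
    unfolding extends_continuously_def
  proof (intro exI conjI ballI)
    show "continuous_map ?K euclideanreal (\<lambda>t. t f)"
      unfolding P_def
      by (rule continuous_map_from_subtopology, rule continuous_map_product_projection[OF that])
  qed (use that in \<open>auto simp: e_def\<close>)
  have "ext_le ?Z ?K e M i"
    if M: "realcompactification ?Z M i" and Mf: "\<forall>f\<in>L. extends_continuously ?Z M i f"
    for M :: "'a set set topology" and i
  proof -
    obtain F where F: "\<And>f. f \<in> L \<Longrightarrow> continuous_map M euclideanreal (F f)"
        "\<And>f z. f \<in> L \<Longrightarrow> z \<in> mspace m \<Longrightarrow> F f (i z) = f z"
      using Mf unfolding extends_continuously_def topspace_mtopology_of by metis
    define h where "h = (\<lambda>k. restrict (\<lambda>f. F f k) L)"
    have hc: "continuous_map M P h"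
      unfolding P_def continuous_map_componentwise
      by (auto simp: h_def F)
    have hi: "h (i z) = e z" if "z \<in> mspace m" for z
      using that F by (auto simp: h_def e_def fun_eq_iff restrict_def)
    have "h ` topspace M \<subseteq> P closure_of (h ` i ` mspace m)"
      using continuous_map_image_closure_subset[OF hc, of "i ` mspace m"] M
      by (simp add: realcompactification_def)
    also have "h ` i ` mspace m = e ` mspace m"
      using hi by (auto simp: image_comp)
    finally have "continuous_map M ?K h"
      using hc by (auto simp: continuous_map_in_subtopology)
    then show ?thesis
      unfolding ext_le_def using hi by auto
  qed
  then show ?thesis
    unfolding H_realcompactification_def realcompactification_def
    using rc emb dense ext by blast
qed

corollary samuel_realcompactification_exists:
  "\<exists>(K :: (('a \<Rightarrow> real) \<Rightarrow> real) topology) e. samuel_realcompactification (m :: 'a metric) K e"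
proof -
  have "continuous_map (mtopology_of m) euclideanreal f" if "f \<in> unif_cont_funs m" for f
    using uniformly_continuous_imp_continuous_map[of m euclidean_metric f] that
    by (simp add: unif_cont_funs_def)
  then show ?thesis
    unfolding samuel_realcompactification_def
    using H_realcompactification_exists[of m "unif_cont_funs m"] by blast
qed

corollary hewitt_realcompactification_exists:
  "\<exists>(K :: (('a \<Rightarrow> real) \<Rightarrow> real) topology) e.
     hewitt_realcompactification (mtopology_of (m :: 'a metric)) K e"
proof -
  let ?L = "{f. continuous_map (mtopology_of m) euclideanreal f}"
  have "unif_cont_funs m \<subseteq> ?L"
    using uniformly_continuous_imp_continuous_map[of m euclidean_metric]
    by (auto simp: unif_cont_funs_def)
  then show ?thesis
    using H_realcompactification_exists[of m ?L]
    unfolding H_realcompactification_def hewitt_realcompactification_def by blast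
qed

end

theory Submission
  imports Defs
begin

text \<open>
  Write \<open>H\<close> and \<open>\<upsilon>\<close> for the Samuel and the Hewitt realcompactification.  Two realcompactifications of
  a space coincide as soon as each maps to the other over the base space (\<open>ext_le_antisym\<close>), and a map
  into a realcompact space, being a closed subspace of a power of \<open>\<real>\<close>, extends over a dense embedding
  as soon as its coordinates do.  Hence \<open>\<upsilon>Z\<close> is the greatest realcompactification of \<open>Z\<close> and is unique.

  The space \<open>X\<close> is realcompact, so \<open>X = \<upsilon>X\<close>, and by hypothesis \<open>X = H(U(X))\<close>; every function on \<open>D\<close>
  is uniformly continuous, so \<open>H(U(D)) = \<upsilon>D\<close>.  This identifies the three products in the statement with
  \<open>X \<times> \<upsilon>D\<close>, and two facts remain.

  The first is \<open>\<upsilon>(X \<times> D) = X \<times> \<upsilon>D\<close>, which holds for every realcompact metric space \<open>X\<close>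
  (\<open>hewitt_realcompactification_prod_discrete\<close>).  A continuous \<open>f\<close> on \<open>X \<times> D\<close> extends in the second
  variable, for each \<open>x\<close> separately, to a function \<open>G x\<close> on \<open>\<upsilon>D\<close>.  For joint continuity at \<open>(x, p)\<close>,
  choose for each \<open>d\<close> a radius \<open>r d > 0\<close> such that \<open>f(\<cdot>, d)\<close> varies by less than \<open>\<epsilon>/2\<close> on the ball
  around \<open>x\<close> of radius \<open>r d\<close>.  As \<open>D\<close> is discrete, \<open>1/r\<close> is continuous on \<open>D\<close>, so it extends to
  \<open>\<upsilon>D\<close> and is bounded near \<open>p\<close>; on a neighbourhood of \<open>p\<close> one radius therefore serves for all \<open>d\<close>,
  and the estimate passes to \<open>\<upsilon>D\<close> by density.

  The second is \<open>H(U(X \<times> D)) = H(U(X)) \<times> H(U(D))\<close>.  Uniformly continuous functions of one variable are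
  uniformly continuous on the product, so \<open>H(U(X \<times> D))\<close> maps to both factors
  (\<open>ext_le_samuel_realcompactification_prod\<close>).  Conversely every continuous function extends to
  \<open>X \<times> \<upsilon>D\<close>, in particular every uniformly continuous one, and \<open>H(U(X \<times> D))\<close> is the least
  realcompactification with this property.
\<close>

section \<open>The sum metric and the discrete metric\<close>

lemma mtopology_of_sum_metric:
  "mtopology_of (sum_metric m1 m2) = prod_topology (mtopology_of m1) (mtopology_of m2)"
proof -
  let ?S = "mtopology_of (sum_metric m1 m2)"
  let ?P = "prod_topology (mtopology_of m1) (mtopology_of m2)"
  have S: "?S = Metric_space.mtopology (mspace (sum_metric m1 m2)) (mdist (sum_metric m1 m2))"
    by (simp only: mtopology_of_def)
  have "Lipschitz_continuous_map (sum_metric m1 m2) m1 fst"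
    "Lipschitz_continuous_map (sum_metric m1 m2) m2 snd"
    unfolding Lipschitz_continuous_map_def by (force intro!: exI[of _ 1])+
  then have "continuous_map ?S ?P id"
    by (simp add: continuous_map_pairwise Lipschitz_continuous_imp_continuous_map)
  moreover have "continuous_map ?P ?S id"
    unfolding S Metric_space.continuous_map_to_metric[OF Metric_space_mspace_mdist]
  proof (intro ballI allI impI)
    fix p and \<epsilon> :: real
    assume p: "p \<in> topspace ?P" and "\<epsilon> > 0"
    let ?U = "mball_of m1 (fst p) (\<epsilon>/2) \<times> mball_of m2 (snd p) (\<epsilon>/2)"
    have "openin ?P ?U"
      by (simp add: openin_prod_Times_iff mball_of_def mtopology_of_def
          Metric_space.openin_mball[OF Metric_space_mspace_mdist])
    moreover have "p \<in> ?U"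
      using p \<open>\<epsilon> > 0\<close>
      by (auto simp: mem_Times_iff Metric_space.mdist_zero[OF Metric_space_mspace_mdist])
    moreover have "\<forall>q\<in>?U. id q \<in> mball_of (sum_metric m1 m2) (id p) \<epsilon>"
      using p by auto
    ultimately have "\<exists>U. openin ?P U \<and> p \<in> U \<and> (\<forall>q\<in>U. id q \<in> mball_of (sum_metric m1 m2) (id p) \<epsilon>)"
      by blast
    then show "\<exists>U. openin ?P U \<and> p \<in> U \<and> (\<forall>q\<in>U. id q \<in>
        Metric_space.mball (mspace (sum_metric m1 m2)) (mdist (sum_metric m1 m2)) (id p) \<epsilon>)"
      unfolding mball_of_def .
  qed
  ultimately have "homeomorphic_maps ?S ?P id id"
    by (simp add: homeomorphic_maps_def)
  then show ?thesis
    by (simp add: homeomorphic_maps_id)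
qed

lemma mtopology_of_unif_discrete_metric:
  "mtopology_of (unif_discrete_metric D) = discrete_topology D"
  using discrete_metric.mtopology_discrete_metric[of D]
  by (simp add: mtopology_of_def discrete_metric.dd_def)

text \<open>The constant \<open>\<delta> = 1\<close> witnesses uniform continuity, since distinct points have distance 1.\<close>

lemma unif_cont_funs_unif_discrete_metric:
  "unif_cont_funs (unif_discrete_metric D) = UNIV"
  by (auto simp: unif_cont_funs_def uniformly_continuous_map_def intro!: exI[of _ 1])

lemma unif_cont_funs_sum_metric_fst:
  assumes "f \<in> unif_cont_funs m1"
  shows "f \<circ> fst \<in> unif_cont_funs (sum_metric m1 m2)"
proof -
  have "Lipschitz_continuous_map (sum_metric m1 m2) m1 fst"
    unfolding Lipschitz_continuous_map_def by (force intro!: exI[of _ 1])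
  then show ?thesis
    using assms by (auto simp: unif_cont_funs_def
        intro: uniformly_continuous_map_compose Lipschitz_imp_uniformly_continuous_map)
qed

lemma unif_cont_funs_sum_metric_snd:
  assumes "f \<in> unif_cont_funs m2"
  shows "f \<circ> snd \<in> unif_cont_funs (sum_metric m1 m2)"
proof -
  have "Lipschitz_continuous_map (sum_metric m1 m2) m2 snd"
    unfolding Lipschitz_continuous_map_def by (force intro!: exI[of _ 1])
  then show ?thesis
    using assms by (auto simp: unif_cont_funs_def
        intro: uniformly_continuous_map_compose Lipschitz_imp_uniformly_continuous_map)
qed

lemma unif_cont_funs_imp_continuous_map:
  "f \<in> unif_cont_funs m \<Longrightarrow> continuous_map (mtopology_of m) euclideanreal f"
  using uniformly_continuous_imp_continuous_map[of m euclidean_metric f]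
  by (simp add: unif_cont_funs_def)


section \<open>Comparing extensions\<close>

lemma ext_le_extends:
  assumes "ext_le Z K e M j" "extends_continuously Z K e f"
  shows "extends_continuously Z M j f"
proof -
  obtain h F where "continuous_map M K h" "\<forall>z\<in>topspace Z. h (j z) = e z"
      "continuous_map K euclideanreal F" "\<forall>z\<in>topspace Z. F (e z) = f z"
    using assms unfolding ext_le_def extends_continuously_def by blast
  then show ?thesis
    unfolding extends_continuously_def
    by (intro exI[of _ "F \<circ> h"]) (auto intro: continuous_map_compose)
qed

lemma ext_le_prod:
  assumes "ext_le Z1 K1 e1 M1 i1" "ext_le Z2 K2 e2 M2 i2"
  shows "ext_le (prod_topology Z1 Z2) (prod_topology K1 K2) (map_prod e1 e2)
           (prod_topology M1 M2) (map_prod i1 i2)"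
proof -
  obtain h1 h2 where "continuous_map M1 K1 h1" "\<forall>z\<in>topspace Z1. h1 (i1 z) = e1 z"
      "continuous_map M2 K2 h2" "\<forall>z\<in>topspace Z2. h2 (i2 z) = e2 z"
    using assms unfolding ext_le_def by blast
  then show ?thesis
    unfolding ext_le_def
    by (intro exI[of _ "\<lambda>(x, y). (h1 x, h2 y)"]) (auto simp: continuous_map_prod_top)
qed

lemma realcompactificationD:
  assumes "realcompactification Z K e"
  shows "realcompact_space K" "Hausdorff_space K" "continuous_map Z K e"
    "K closure_of (e ` topspace Z) = topspace K"
  using assms realcompact_imp_Hausdorff_space
  by (auto simp: realcompactification_def embedding_map_def continuous_map_in_subtopology
      dest: homeomorphic_imp_continuous_map)

lemma ext_le_antisym:
  assumes K: "realcompactification Z K e" and M: "realcompactification Z M i"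
    and KM: "ext_le Z K e M i" and MK: "ext_le Z M i K e"
  shows "ext_equiv Z K e M i"
proof -
  obtain h where h: "continuous_map M K h" "\<forall>z\<in>topspace Z. h (i z) = e z"
    using KM unfolding ext_le_def by blast
  obtain k where k: "continuous_map K M k" "\<forall>z\<in>topspace Z. k (e z) = i z"
    using MK unfolding ext_le_def by blast
  have "(h \<circ> k) x = id x" if "x \<in> topspace K" for x
  proof (rule forall_in_closure_of_eq[of x K "e ` topspace Z" K])
    show "continuous_map K K (h \<circ> k)"
      using h k by (auto intro: continuous_map_compose)
  qed (use that h k realcompactificationD[OF K] in auto)
  moreover have "(k \<circ> h) x = id x" if "x \<in> topspace M" for x
  proof (rule forall_in_closure_of_eq[of x M "i ` topspace Z" M])
    show "continuous_map M M (k \<circ> h)"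
      using h k by (auto intro: continuous_map_compose)
  qed (use that h k realcompactificationD[OF M] in auto)
  ultimately have "homeomorphic_maps K M k h"
    using h k by (simp add: homeomorphic_maps_def)
  then show ?thesis
    unfolding ext_equiv_def using k homeomorphic_maps_map by blast
qed


section \<open>Extending maps into realcompact spaces\<close>

text \<open>The coordinates of a map into a closed subspace of \<open>\<real>\<^sup>I\<close> may be extended one by one: the
  extended map stays in the subspace because \<open>Z\<close> is dense.\<close>

lemma extension_into_closed_subspace:
  fixes I :: "'i set"
  defines "P \<equiv> product_topology (\<lambda>_. euclideanreal) I"
  assumes S: "closedin P S"
    and dense: "M closure_of (e ` topspace Z) = topspace M"
    and \<phi>: "\<phi> \<in> topspace Z \<rightarrow> S"
    and ext: "\<And>i. i \<in> I \<Longrightarrow> extends_continuously Z M e (\<lambda>z. \<phi> z i)"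
  shows "\<exists>h. continuous_map M (subtopology P S) h \<and> (\<forall>z\<in>topspace Z. h (e z) = \<phi> z)"
proof -
  obtain F where F: "\<And>i. i \<in> I \<Longrightarrow> continuous_map M euclideanreal (F i)"
      "\<And>i z. i \<in> I \<Longrightarrow> z \<in> topspace Z \<Longrightarrow> F i (e z) = \<phi> z i"
    using ext unfolding extends_continuously_def by metis
  define h where "h = (\<lambda>x. restrict (\<lambda>i. F i x) I)"
  have hc: "continuous_map M P h"
    unfolding P_def continuous_map_componentwise by (auto simp: h_def F)
  have he: "h (e z) = \<phi> z" if "z \<in> topspace Z" for z
  proof -
    have "\<phi> z \<in> topspace P"
      using \<phi> that closedin_subset[OF S] by blast
    then show ?thesis
      using that by (auto simp: h_def F P_def PiE_def extensional_def fun_eq_iff)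
  qed
  have "h ` topspace M \<subseteq> P closure_of (h ` e ` topspace Z)"
    using continuous_map_image_closure_subset[OF hc, of "e ` topspace Z"] dense by simp
  also have "\<dots> \<subseteq> S"
    using S \<phi> he by (intro closure_of_minimal) (auto simp: Pi_iff)
  finally show ?thesis
    using hc he by (auto simp: continuous_map_in_subtopology)
qed

lemma extension_into_realcompact_space:
  fixes K :: "'k topology"
  assumes K: "realcompact_space K"
    and dense: "M closure_of (e ` topspace Z) = topspace M"
    and \<phi>: "\<phi> \<in> topspace Z \<rightarrow> topspace K"
    and ext: "\<And>g. continuous_map K euclideanreal g \<Longrightarrow> extends_continuously Z M e (g \<circ> \<phi>)"
  shows "\<exists>h. continuous_map M K h \<and> (\<forall>z\<in>topspace Z. h (e z) = \<phi> z)"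
proof -
  obtain I :: "('k \<Rightarrow> real) set" and S where
    S: "closedin (product_topology (\<lambda>_. euclideanreal) I) S"
    and "K homeomorphic_space subtopology (product_topology (\<lambda>_. euclideanreal) I) S"
    using K unfolding realcompact_space_def by blast
  then obtain a b where
    ab: "homeomorphic_maps K (subtopology (product_topology (\<lambda>_. euclideanreal) I) S) a b"
    unfolding homeomorphic_space_def by blast
  then have a: "continuous_map K (subtopology (product_topology (\<lambda>_. euclideanreal) I) S) a"
    and b: "continuous_map (subtopology (product_topology (\<lambda>_. euclideanreal) I) S) K b"
    and ba: "\<And>x. x \<in> topspace K \<Longrightarrow> b (a x) = x"
    by (auto simp: homeomorphic_maps_def)
  have "\<exists>h. continuous_map M (subtopology (product_topology (\<lambda>_. euclideanreal) I) S) h \<and>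
      (\<forall>z\<in>topspace Z. h (e z) = (a \<circ> \<phi>) z)"
  proof (rule extension_into_closed_subspace[OF S dense])
    show "a \<circ> \<phi> \<in> topspace Z \<rightarrow> S"
      using \<phi> a by (auto simp: continuous_map_in_subtopology)
    show "extends_continuously Z M e (\<lambda>z. (a \<circ> \<phi>) z i)" if "i \<in> I" for i
    proof -
      have "continuous_map K euclideanreal (\<lambda>x. a x i)"
        using a that by (auto simp: continuous_map_in_subtopology continuous_map_componentwise)
      then show ?thesis
        using ext[of "\<lambda>x. a x i"] by (simp add: o_def)
    qed
  qed
  then obtain h where h: "continuous_map M (subtopology (product_topology (\<lambda>_. euclideanreal) I) S) h"
      "\<forall>z\<in>topspace Z. h (e z) = a (\<phi> z)"
    by auto
  show ?thesis
    using continuous_map_compose[OF h(1) b] h(2) ba \<phi> by (intro exI[of _ "b \<circ> h"]) auto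
qed


section \<open>Hewitt and Samuel realcompactifications\<close>

lemma hewitt_realcompactification_greatest:
  assumes N: "hewitt_realcompactification Z N j" and K: "realcompactification Z K e"
  shows "ext_le Z K e N j"
  unfolding ext_le_def
proof (rule extension_into_realcompact_space)
  show "N closure_of (j ` topspace Z) = topspace N"
    using N realcompactificationD(4) unfolding hewitt_realcompactification_def by blast
  show "extends_continuously Z N j (g \<circ> e)" if "continuous_map K euclideanreal g" for g
    using N continuous_map_compose[OF realcompactificationD(3)[OF K] that]
    unfolding hewitt_realcompactification_def by blast
qed (use realcompactificationD[OF K] in \<open>auto simp: continuous_map_def\<close>)

lemma hewitt_realcompactification_unique:
  assumes "hewitt_realcompactification Z N j" "hewitt_realcompactification Z N' j'"
  shows "ext_equiv Z N j N' j'"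
  using assms ext_le_antisym hewitt_realcompactification_greatest
  unfolding hewitt_realcompactification_def by metis

lemma realcompact_space_imp_hewitt_realcompactification_id:
  assumes "realcompact_space Z"
  shows "hewitt_realcompactification Z Z id"
  using assms
  by (auto simp: hewitt_realcompactification_def realcompactification_def extends_continuously_def
      embedding_map_def)

lemma H_realcompactification_ext_le:
  assumes "H_realcompactification Z L K e" "H_realcompactification Z L M i"
  shows "ext_le Z K e M i"
  using assms H_realcompactification_least[OF assms(1)]
  unfolding H_realcompactification_def by blast

text \<open>Compared with \<open>extension_into_realcompact_space\<close>, fewer functions have to be extended.  The model of \<open>H(U(m))\<close> as the closure of the image of the evaluation map in a power of \<open>\<real>\<close> has
  the uniformly continuous functions as its coordinates, so only these have to be extended.\<close>

lemma extension_into_samuel_realcompactification: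
  fixes m :: "'a metric" and Z :: "'z topology"
  assumes K: "samuel_realcompactification m K e"
    and dense: "M closure_of (i ` topspace Z) = topspace M"
    and \<pi>: "\<pi> \<in> topspace Z \<rightarrow> mspace m"
    and ext: "\<And>f. f \<in> unif_cont_funs m \<Longrightarrow> extends_continuously Z M i (f \<circ> \<pi>)"
  shows "\<exists>h. continuous_map M K h \<and> (\<forall>z\<in>topspace Z. h (i z) = e (\<pi> z))"
proof -
  let ?L = "unif_cont_funs m"
  let ?P = "product_topology (\<lambda>_. euclideanreal) ?L"
  define ev where "ev = (\<lambda>z. restrict (\<lambda>f. f z) ?L)"
  let ?S = "?P closure_of (ev ` mspace m)"
  have "H_realcompactification (mtopology_of m) ?L (subtopology ?P ?S) ev"
    unfolding ev_def
    by (rule H_realcompactification_exists) (auto intro: unif_cont_funs_imp_continuous_map)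
  then have "ext_le (mtopology_of m) K e (subtopology ?P ?S) ev"
    using K H_realcompactification_ext_le unfolding samuel_realcompactification_def by blast
  then obtain k where k: "continuous_map (subtopology ?P ?S) K k" "\<forall>z\<in>mspace m. k (ev z) = e z"
    unfolding ext_le_def by auto
  have "\<exists>h. continuous_map M (subtopology ?P ?S) h \<and> (\<forall>z\<in>topspace Z. h (i z) = (ev \<circ> \<pi>) z)"
  proof (rule extension_into_closed_subspace[OF _ dense])
    have "ev ` mspace m \<subseteq> ?S"
      by (rule closure_of_subset) (auto simp: ev_def)
    then show "ev \<circ> \<pi> \<in> topspace Z \<rightarrow> ?S"
      using \<pi> unfolding image_subset_iff Pi_iff o_def by blast
    show "extends_continuously Z M i (\<lambda>z. (ev \<circ> \<pi>) z f)" if "f \<in> ?L" for f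
      using ext[OF that] that by (simp add: ev_def o_def)
  qed simp
  then obtain h where "continuous_map M (subtopology ?P ?S) h"
      "\<forall>z\<in>topspace Z. h (i z) = ev (\<pi> z)"
    by auto
  then show ?thesis
    using k \<pi> by (intro exI[of _ "k \<circ> h"]) (auto intro: continuous_map_compose)
qed

lemma samuel_imp_hewitt_realcompactification_unif_discrete:
  assumes "samuel_realcompactification (unif_discrete_metric D) K e"
  shows "hewitt_realcompactification (discrete_topology D) K e"
  using assms
  by (simp add: samuel_realcompactification_def H_realcompactification_def
      hewitt_realcompactification_def mtopology_of_unif_discrete_metric
      unif_cont_funs_unif_discrete_metric)


section \<open>Products of realcompactifications\<close>

lemma realcompact_space_prod_topology:
  fixes K1 :: "'k topology" and K2 :: "'l topology"
  assumes "realcompact_space K1" "realcompact_space K2"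
  shows "realcompact_space (prod_topology K1 K2)"
proof -
  let ?P = "\<lambda>J. product_topology (\<lambda>_. euclideanreal) J"
  obtain I1 :: "('k \<Rightarrow> real) set" and S1 where S1: "closedin (?P I1) S1"
      "K1 homeomorphic_space subtopology (?P I1) S1"
    using assms(1) unfolding realcompact_space_def by blast
  obtain I2 :: "('l \<Rightarrow> real) set" and S2 where S2: "closedin (?P I2) S2"
      "K2 homeomorphic_space subtopology (?P I2) S2"
    using assms(2) unfolding realcompact_space_def by blast
  \<comment> \<open>A product of two powers of \<open>\<real>\<close> is the power indexed by the disjoint union of the index sets.\<close>
  let ?Q = "prod_topology (?P I1) (?P I2)" and ?R = "?P (I1 <+> I2)"
  define a where "a = (\<lambda>(s, t). restrict (case_sum s t) (I1 <+> I2) :: _ \<Rightarrow> real)"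
  define b :: "(('k \<Rightarrow> real) + ('l \<Rightarrow> real) \<Rightarrow> real) \<Rightarrow> _" where
    "b = (\<lambda>u. (restrict (u \<circ> Inl) I1, restrict (u \<circ> Inr) I2))"
  have ca: "continuous_map ?Q ?R a"
    unfolding continuous_map_componentwise
  proof (intro conjI ballI)
    fix i assume "i \<in> I1 <+> I2"
    then show "continuous_map ?Q euclideanreal (\<lambda>x. a x i)"
    proof
      fix i1 assume i1: "i1 \<in> I1" "i = Inl i1"
      then have "continuous_map ?Q euclideanreal ((\<lambda>s. s i1) \<circ> fst)"
        by (intro continuous_map_compose[OF continuous_map_fst] continuous_map_product_projection)
      moreover have "(\<lambda>x. a x i) = (\<lambda>s. s i1) \<circ> fst"
        using i1 by (auto simp: a_def fun_eq_iff)
      ultimately show ?thesis by simp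
    next
      fix i2 assume i2: "i2 \<in> I2" "i = Inr i2"
      then have "continuous_map ?Q euclideanreal ((\<lambda>s. s i2) \<circ> snd)"
        by (intro continuous_map_compose[OF continuous_map_snd] continuous_map_product_projection)
      moreover have "(\<lambda>x. a x i) = (\<lambda>s. s i2) \<circ> snd"
        using i2 by (auto simp: a_def fun_eq_iff)
      ultimately show ?thesis by simp
    qed
  qed (auto simp: a_def)
  have cb: "continuous_map ?R ?Q b"
    unfolding b_def continuous_map_paired continuous_map_componentwise
    by (auto intro!: continuous_map_product_projection)
  have ba: "b (a x) = x" if "x \<in> topspace ?Q" for x
    using that by (auto simp: a_def b_def PiE_def extensional_def fun_eq_iff)
  have ab: "a (b u) = u" if "u \<in> topspace ?R" for u
    using that by (auto simp: a_def b_def PiE_def extensional_def fun_eq_iff split: sum.splits)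
  have hab: "homeomorphic_maps ?Q ?R a b"
    unfolding homeomorphic_maps_def using ca cb ba ab by blast
  then have ha: "homeomorphic_map ?Q ?R a"
    using homeomorphic_maps_map by blast
  have "closedin ?Q (S1 \<times> S2)"
    using S1 S2 by (simp add: closedin_prod_Times_iff)
  moreover from this have sub: "S1 \<times> S2 \<subseteq> topspace ?Q"
    by (rule closedin_subset)
  ultimately have cl: "closedin ?R (a ` (S1 \<times> S2))"
    by (rule homeomorphic_map_closedness[OF ha, THEN iffD2, rotated])
  have "prod_topology K1 K2 homeomorphic_space subtopology ?Q (S1 \<times> S2)"
    using homeomorphic_space_prod_topology[OF S1(2) S2(2)] by (simp add: subtopology_Times)
  moreover have "subtopology ?Q (S1 \<times> S2) homeomorphic_space subtopology ?R (a ` (S1 \<times> S2))"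
  proof -
    have "a ` (topspace ?Q \<inter> S1 \<times> S2) = topspace ?R \<inter> a ` (S1 \<times> S2)"
      using sub closedin_subset[OF cl] by (simp only: Int_absorb1)
    from homeomorphic_map_subtopologies[OF ha this] show ?thesis
      by (rule homeomorphic_map_imp_homeomorphic_space)
  qed
  ultimately show ?thesis
    using cl homeomorphic_space_trans realcompact_spaceI by blast
qed

lemma realcompactification_prod:
  assumes 1: "realcompactification Z1 K1 e1" and 2: "realcompactification Z2 K2 e2"
  shows "realcompactification (prod_topology Z1 Z2) (prod_topology K1 K2) (map_prod e1 e2)"
proof -
  obtain f1 where f1: "homeomorphic_maps Z1 (subtopology K1 (e1 ` topspace Z1)) e1 f1"
    using 1 homeomorphic_map_maps unfolding realcompactification_def embedding_map_def by blast
  obtain f2 where f2: "homeomorphic_maps Z2 (subtopology K2 (e2 ` topspace Z2)) e2 f2"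
    using 2 homeomorphic_map_maps unfolding realcompactification_def embedding_map_def by blast
  have "homeomorphic_maps (prod_topology Z1 Z2)
      (prod_topology (subtopology K1 (e1 ` topspace Z1)) (subtopology K2 (e2 ` topspace Z2)))
      (map_prod e1 e2) (map_prod f1 f2)"
    unfolding map_prod_def using f1 f2 by (simp add: homeomorphic_maps_prod)
  moreover have "prod_topology (subtopology K1 (e1 ` topspace Z1)) (subtopology K2 (e2 ` topspace Z2))
      = subtopology (prod_topology K1 K2) (map_prod e1 e2 ` topspace (prod_topology Z1 Z2))"
    by (simp add: subtopology_Times map_prod_surj_on[OF refl refl])
  ultimately have "embedding_map (prod_topology Z1 Z2) (prod_topology K1 K2) (map_prod e1 e2)"
    unfolding embedding_map_def using homeomorphic_maps_map by metis
  then show ?thesis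
    using realcompact_space_prod_topology[OF realcompactificationD(1)[OF 1] realcompactificationD(1)[OF 2]]
      realcompactificationD(4)[OF 1] realcompactificationD(4)[OF 2]
    by (simp add: realcompactification_def map_prod_surj_on[OF refl refl] closure_of_Times)
qed

text \<open>The metric space is arbitrary here.  Of \<open>N\<close>, only the density of \<open>j ` D\<close> and the extension of all
  real functions on \<open>D\<close> enter.\<close>

lemma extends_continuously_prod_discrete:
  assumes f: "continuous_map (prod_topology (mtopology_of m) (discrete_topology D)) euclideanreal f"
    and N: "hewitt_realcompactification (discrete_topology D) N j"
  shows "extends_continuously (prod_topology (mtopology_of m) (discrete_topology D))
           (prod_topology (mtopology_of m) N) (map_prod id j) f"
proof -
  interpret Metric_space "mspace m" "mdist m"
    by (rule Metric_space_mspace_mdist)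
  let ?X = "mtopology_of m"
  have X: "?X = mtopology"
    by (simp add: mtopology_of_def)
  have dense: "N closure_of (j ` D) = topspace N"
    using N by (simp add: hewitt_realcompactification_def realcompactification_def)
  have extN: "\<exists>G. continuous_map N euclideanreal G \<and> (\<forall>d\<in>D. G (j d) = g d)" for g :: "'b \<Rightarrow> real"
    using N by (simp add: hewitt_realcompactification_def extends_continuously_def)
  then obtain G where Gc: "\<And>x. continuous_map N euclideanreal (G x)"
    and Gj: "\<And>x d. d \<in> D \<Longrightarrow> G x (j d) = f (x, d)"
  proof -
    have "\<forall>x. \<exists>G. continuous_map N euclideanreal G \<and> (\<forall>d\<in>D. G (j d) = f (x, d))"
      by (intro allI extN)
    from choice[OF this] show thesis
      using that by blast
  qed
  have fx: "continuous_map ?X euclideanreal (\<lambda>x. f (x, d))" if "d \<in> D" for d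
  proof -
    have "continuous_map ?X (prod_topology ?X (discrete_topology D)) (\<lambda>x. (x, d))"
      using that by (simp add: continuous_map_paired)
    from continuous_map_compose[OF this f] show ?thesis
      by (simp add: o_def)
  qed
  have "continuous_map (prod_topology ?X N) euclideanreal (\<lambda>(x, p). G x p)"
    unfolding mtopology_is_euclidean[symmetric] Met_TC.continuous_map_to_metric
  proof (intro ballI allI impI)
    fix q and \<epsilon> :: real
    assume "q \<in> topspace (prod_topology ?X N)" and \<epsilon>: "\<epsilon> > 0"
    then obtain x p where q: "q = (x, p)" and x: "x \<in> mspace m" and p: "p \<in> topspace N"
      by auto
    have "\<exists>r>0. \<forall>y. y \<in> mspace m \<and> mdist m x y < r \<longrightarrow> f (y, d) \<in> ball (f (x, d)) (\<epsilon>/2)"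
      if "d \<in> D" for d
    proof -
      have "openin euclideanreal (ball (f (x, d)) (\<epsilon>/2))" "f (x, d) \<in> ball (f (x, d)) (\<epsilon>/2)"
        using \<epsilon> by auto
      then show ?thesis
        using fx[OF that] x unfolding X continuous_map_from_metric by blast
    qed
    then obtain r where r: "\<And>d. d \<in> D \<Longrightarrow> r d > 0"
      "\<And>d y. d \<in> D \<Longrightarrow> y \<in> mspace m \<Longrightarrow> mdist m x y < r d \<Longrightarrow> \<bar>f (x, d) - f (y, d)\<bar> < \<epsilon>/2"
      unfolding mem_ball dist_real_def by metis
    \<comment> \<open>The radii \<open>r d\<close> need not be bounded below, but \<open>1 / r\<close> extends to \<open>N\<close> as well, so it is
       bounded near \<open>p\<close>.\<close>
    obtain R where Rc: "continuous_map N euclideanreal R" and Rj: "\<And>d. d \<in> D \<Longrightarrow> R (j d) = 1 / r d"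
      using extN[of "\<lambda>d. 1 / r d"] by blast
    define c where "c = \<bar>R p\<bar> + 1"
    have c: "c > 0" "R p < c"
      by (auto simp: c_def)
    define V where "V = {p' \<in> topspace N. R p' \<in> {..<c}}"
    define W where "W = {p' \<in> topspace N. G x p' \<in> ball (G x p) (\<epsilon>/2)}"
    have V: "openin N V" and W: "openin N W"
      unfolding V_def W_def
      by (rule openin_continuous_map_preimage[OF Rc] openin_continuous_map_preimage[OF Gc]; simp)+
    \<comment> \<open>For points \<open>p' = j d\<close> this is the choice of \<open>r\<close>, because \<open>1/c < r d\<close>; the condition on \<open>p'\<close> is
       closed, and \<open>j ` D\<close> is dense in the open set \<open>V\<close>.\<close>
    have near: "\<bar>G x p' - G y p'\<bar> \<le> \<epsilon>/2" if "p' \<in> V" "y \<in> mspace m" "mdist m x y < 1/c" for p' y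
    proof (rule forall_in_closure_of[of p' N "V \<inter> j ` D"])
      show "p' \<in> N closure_of (V \<inter> j ` D)"
        using that(1) openin_Int_closure_of_subset[OF V, of "j ` D"] dense openin_subset[OF V] by blast
      have "continuous_map N euclideanreal (\<lambda>p'. \<bar>G x p' - G y p'\<bar>)"
        by (intro continuous_map_real_abs continuous_map_diff Gc)
      from closedin_continuous_map_preimage[OF this, of "{..\<epsilon>/2}"]
      show "closedin N {p' \<in> topspace N. \<bar>G x p' - G y p'\<bar> \<le> \<epsilon>/2}"
        by simp
      fix k assume "k \<in> V \<inter> j ` D"
      then obtain d where d: "d \<in> D" "k = j d" "1 / r d < c"
        by (auto simp: V_def Rj)
      then have "1 / c < r d"
        using c r(1)[OF d(1)] by (simp add: field_simps)
      then show "\<bar>G x k - G y k\<bar> \<le> \<epsilon>/2"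
        using r(2)[OF d(1) that(2)] that(3) d by (simp add: Gj)
    qed
    let ?U = "mball x (1/c) \<times> (V \<inter> W)"
    have "openin (prod_topology ?X N) ?U"
      using V W by (simp add: X openin_prod_Times_iff openin_Int)
    moreover have "q \<in> ?U"
      using q x p c \<epsilon> by (auto simp: V_def W_def)
    moreover have "(case q' of (y, p') \<Rightarrow> G y p') \<in> Met_TC.mball (case q of (x, p) \<Rightarrow> G x p) \<epsilon>"
      if q'U: "q' \<in> ?U" for q'
    proof -
      obtain y p' where q': "q' = (y, p')" "y \<in> mspace m" "mdist m x y < 1/c" "p' \<in> V" "p' \<in> W"
        using q'U by (cases q') auto
      then have "\<bar>G x p' - G y p'\<bar> \<le> \<epsilon>/2" "\<bar>G x p - G x p'\<bar> < \<epsilon>/2"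
        using near by (auto simp: W_def dist_real_def)
      then have "dist (G x p) (G y p') < \<epsilon>"
        unfolding dist_real_def by linarith
      then show ?thesis
        using q q' by simp
    qed
    ultimately show "\<exists>U. openin (prod_topology ?X N) U \<and> q \<in> U \<and>
        (\<forall>q'\<in>U. (case q' of (y, p') \<Rightarrow> G y p') \<in> Met_TC.mball (case q of (x, p) \<Rightarrow> G x p) \<epsilon>)"
      by blast
  qed
  then show ?thesis
    unfolding extends_continuously_def
    by (intro exI[of _ "\<lambda>(x, p). G x p"]) (auto simp: Gj)
qed

lemma hewitt_realcompactification_prod_discrete:
  assumes "realcompact_space (mtopology_of m)"
    and "hewitt_realcompactification (discrete_topology D) N j"
  shows "hewitt_realcompactification (prod_topology (mtopology_of m) (discrete_topology D))
           (prod_topology (mtopology_of m) N) (map_prod id j)"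
  using assms realcompact_space_imp_hewitt_realcompactification_id[OF assms(1)]
  by (simp add: hewitt_realcompactification_def realcompactification_prod
      extends_continuously_prod_discrete[OF _ assms(2)])

lemma ext_le_samuel_realcompactification_prod:
  fixes m1 :: "'a metric" and m2 :: "'b metric"
  defines "Z \<equiv> mtopology_of (sum_metric m1 m2)"
  assumes H: "samuel_realcompactification (sum_metric m1 m2) H i"
    and H1: "samuel_realcompactification m1 H1 i1" and H2: "samuel_realcompactification m2 H2 i2"
  shows "ext_le Z (prod_topology H1 H2) (map_prod i1 i2) H i"
proof -
  have dense: "H closure_of (i ` topspace Z) = topspace H"
    and ext: "\<And>f. f \<in> unif_cont_funs (sum_metric m1 m2) \<Longrightarrow> extends_continuously Z H i f"
    using H by (auto simp: samuel_realcompactification_def H_realcompactification_def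
        realcompactification_def Z_def)
  have "fst \<in> topspace Z \<rightarrow> mspace m1" "snd \<in> topspace Z \<rightarrow> mspace m2"
    by (auto simp: Z_def)
  then obtain h1 h2 where h1: "continuous_map H H1 h1" "\<forall>z\<in>topspace Z. h1 (i z) = i1 (fst z)"
    and h2: "continuous_map H H2 h2" "\<forall>z\<in>topspace Z. h2 (i z) = i2 (snd z)"
    using extension_into_samuel_realcompactification[OF H1 dense _ ext]
      extension_into_samuel_realcompactification[OF H2 dense _ ext]
      unif_cont_funs_sum_metric_fst unif_cont_funs_sum_metric_snd by metis
  show ?thesis
    unfolding ext_le_def using h1 h2
    by (intro exI[of _ "\<lambda>x. (h1 x, h2 x)"]) (auto simp: continuous_map_paired map_prod_def)
qed


section \<open>The four identifications\<close>

theorem corollary3p2p8: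
  fixes X :: "'a metric" and D :: "'b set"
    and H_XD :: "'h topology" and i_XD :: "'a \<times> 'b \<Rightarrow> 'h"
    and H_X :: "'h1 topology" and i_X :: "'a \<Rightarrow> 'h1"
    and H_D :: "'h2 topology" and i_D :: "'b \<Rightarrow> 'h2"
    and N_X :: "'v1 topology" and j_X :: "'a \<Rightarrow> 'v1"
    and N_D :: "'v2 topology" and j_D :: "'b \<Rightarrow> 'v2"
    and N_XD :: "'v topology" and j_XD :: "'a \<times> 'b \<Rightarrow> 'v"
  defines "XD \<equiv> mtopology_of (sum_metric X (unif_discrete_metric D))"
  assumes "samuel_realcompact X"
    and "samuel_realcompactification (sum_metric X (unif_discrete_metric D)) H_XD i_XD"
    and "samuel_realcompactification X H_X i_X"
    and "samuel_realcompactification (unif_discrete_metric D) H_D i_D"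
    and "hewitt_realcompactification (mtopology_of X) N_X j_X"
    and "hewitt_realcompactification (mtopology_of (unif_discrete_metric D)) N_D j_D"
    and "hewitt_realcompactification XD N_XD j_XD"
  shows "ext_equiv XD H_XD i_XD (prod_topology H_X H_D) (map_prod i_X i_D)
       \<and> ext_equiv XD (prod_topology H_X H_D) (map_prod i_X i_D)
           (prod_topology (mtopology_of X) N_D) (map_prod id j_D)
       \<and> ext_equiv XD (prod_topology (mtopology_of X) N_D) (map_prod id j_D)
           (prod_topology N_X N_D) (map_prod j_X j_D)
       \<and> ext_equiv XD (prod_topology N_X N_D) (map_prod j_X j_D) N_XD j_XD"
proof -
  let ?X = "mtopology_of X" and ?D = "discrete_topology D"
  have XD: "XD = prod_topology ?X ?D"
    by (simp add: XD_def mtopology_of_sum_metric mtopology_of_unif_discrete_metric)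
  have X_sam: "H_realcompactification ?X (unif_cont_funs X) ?X id"
    using assms(2) by (simp add: samuel_realcompact_def samuel_realcompactification_def)
  then have X_rc: "realcompact_space ?X" and X_r: "realcompactification ?X ?X id"
    by (auto simp: H_realcompactification_def realcompactification_def)
  have X_hew: "hewitt_realcompactification ?X ?X id"
    by (rule realcompact_space_imp_hewitt_realcompactification_id[OF X_rc])
  have HX: "H_realcompactification ?X (unif_cont_funs X) H_X i_X"
    using assms(4) by (simp add: samuel_realcompactification_def)
  have HD: "hewitt_realcompactification ?D H_D i_D"
    by (rule samuel_imp_hewitt_realcompactification_unif_discrete[OF assms(5)])
  have ND: "hewitt_realcompactification ?D N_D j_D"
    using assms(7) by (simp add: mtopology_of_unif_discrete_metric)
  note r = HX[unfolded H_realcompactification_def, THEN conjunct1]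
    HD[unfolded hewitt_realcompactification_def, THEN conjunct1]
    ND[unfolded hewitt_realcompactification_def, THEN conjunct1]
    assms(6)[unfolded hewitt_realcompactification_def, THEN conjunct1]
    X_r
  have XN: "hewitt_realcompactification XD (prod_topology ?X N_D) (map_prod id j_D)"
    unfolding XD by (rule hewitt_realcompactification_prod_discrete[OF X_rc ND])
  have rHH: "realcompactification XD (prod_topology H_X H_D) (map_prod i_X i_D)"
    and rXN: "realcompactification XD (prod_topology ?X N_D) (map_prod id j_D)"
    and rNN: "realcompactification XD (prod_topology N_X N_D) (map_prod j_X j_D)"
    unfolding XD using r by (auto intro: realcompactification_prod)
  have HH_XN: "ext_le XD (prod_topology H_X H_D) (map_prod i_X i_D)
      (prod_topology ?X N_D) (map_prod id j_D)"
    by (rule hewitt_realcompactification_greatest[OF XN rHH])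
  have XN_HH: "ext_le XD (prod_topology ?X N_D) (map_prod id j_D)
      (prod_topology H_X H_D) (map_prod i_X i_D)"
    unfolding XD using H_realcompactification_ext_le[OF X_sam HX]
      hewitt_realcompactification_greatest[OF HD r(3)] by (rule ext_le_prod)
  have XN_NN: "ext_le XD (prod_topology ?X N_D) (map_prod id j_D)
      (prod_topology N_X N_D) (map_prod j_X j_D)"
    unfolding XD using hewitt_realcompactification_greatest[OF assms(6) X_r]
      hewitt_realcompactification_greatest[OF ND r(3)] by (rule ext_le_prod)
  have NN: "hewitt_realcompactification XD (prod_topology N_X N_D) (map_prod j_X j_D)"
    using rNN XN ext_le_extends[OF XN_NN] by (auto simp: hewitt_realcompactification_def)
  have HXD: "H_realcompactification XD (unif_cont_funs (sum_metric X (unif_discrete_metric D)))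
      H_XD i_XD"
    using assms(3) by (simp add: samuel_realcompactification_def XD_def)
  have "extends_continuously XD (prod_topology H_X H_D) (map_prod i_X i_D) f"
    if "f \<in> unif_cont_funs (sum_metric X (unif_discrete_metric D))" for f
    using ext_le_extends[OF XN_HH] XN unif_cont_funs_imp_continuous_map[OF that]
    by (simp add: hewitt_realcompactification_def XD_def)
  then have "ext_le XD H_XD i_XD (prod_topology H_X H_D) (map_prod i_X i_D)"
    by (rule H_realcompactification_least[OF HXD rHH])
  moreover have "ext_le XD (prod_topology H_X H_D) (map_prod i_X i_D) H_XD i_XD"
    unfolding XD_def by (rule ext_le_samuel_realcompactification_prod[OF assms(3-5)])
  moreover have "realcompactification XD H_XD i_XD"
    using HXD by (simp add: H_realcompactification_def)
  ultimately have "ext_equiv XD H_XD i_XD (prod_topology H_X H_D) (map_prod i_X i_D)"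
    using ext_le_antisym rHH by blast
  then show ?thesis
    using ext_le_antisym[OF rHH rXN HH_XN XN_HH] hewitt_realcompactification_unique[OF XN NN]
      hewitt_realcompactification_unique[OF NN assms(8)] by blast
qed

end
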